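(* Let $x>1$, let $n\ge 0$ be an integer and let $k\in\{0,1,2,\dots,n\}$. Then $$\left(\frac{1-x}{2}\right)^{k}H_{n-k}\left(\frac{1+x}{4}\right)=\frac{n!}{\binom{n}{k}}\sum_{j=0}^{[n/2]}\frac{(-1)^j\,c_k(n-2j,x)}{j!\,(n-2j)!},$$ where $[y]$ denotes the largest integer $\le y$.
   Context: The Hermite polynomials $H_n(z)$ are those defined by $e^{2zt-t^2}=\sum_{n=0}^{\infty}H_n(z)\frac{t^n}{n!}$. For integers $w,k\ge 0$, the superoscillatory coefficients are $c_k(w,x)=\binom{w}{k}\left(\frac{1+x}{2}\right)^{w-k}\left(\frac{1-x}{2}\right)^{k}$ if $k\le w$, and $c_k(w,x)=0$ if $k>w$. *)

theory Defs
  imports Complex_Main "HOL-Computational_Algebra.Polynomial"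
begin

(* A real power series that vanishes everywhere has zero coefficients. *)
lemma powser_sums_zero_imp_coeff_zero:
  fixes a :: "nat \<Rightarrow> real"
  assumes "\<And>t. (\<lambda>n. a n * t ^ n) sums 0"
  shows "a n = 0"
proof (induction n rule: less_induct)
  case (less n)
  have "(\<lambda>i. a (i + n) * t ^ i) sums 0" if "t \<noteq> 0" for t
  proof -
    have "(\<lambda>i. a (i + n) * t ^ (i + n)) sums 0"
      using assms[of t] less.IH by (subst sums_iff_shift) simp
    from sums_mult[OF this, of "inverse (t ^ n)"] show ?thesis
      using that by (simp add: power_add field_simps)
  qed
  then have "((\<lambda>t::real. 0) \<longlongrightarrow> a n) (at (0::real))"
    using powser_limit_0_strong[of 1 "\<lambda>i. a (i + n)" "\<lambda>t. 0"] by simp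
  then show ?case
    using LIM_unique tendsto_const by metis
qed

lemma exp_neg_square_sums:
  fixes t :: real
  defines "b \<equiv> \<lambda>n. (if even n then (-1) ^ (n div 2) / fact (n div 2) else 0) * t ^ n"
  shows "b sums exp (- (t ^ 2))" and "summable (\<lambda>n. norm (b n))"
proof -
  have *: "strict_mono (\<lambda>n::nat. 2 * n)" by (simp add: strict_mono_def)
  have zero: "n \<notin> range (\<lambda>n. 2 * n) \<Longrightarrow> b n = 0" for n
    by (auto simp: b_def elim!: evenE)
  have "(\<lambda>n. b (2 * n)) sums exp (- (t ^ 2))"
    using exp_converges[of "- (t ^ 2)"]
    by (simp add: b_def field_simps power_minus[of "t\<^sup>2"] flip: power_mult)
  then show "b sums exp (- (t ^ 2))"
    using sums_mono_reindex[OF *, of b] zero by simp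
  have "(\<lambda>n. norm (b (2 * n))) sums exp (t ^ 2)"
    using exp_converges[of "t ^ 2"]
    by (simp add: b_def field_simps abs_mult zero_le_even_power flip: power_mult)
  then have "(\<lambda>n. norm (b n)) sums exp (t ^ 2)"
    using sums_mono_reindex[OF *, of "\<lambda>n. norm (b n)"] zero by simp
  then show "summable (\<lambda>n. norm (b n))" by (rule sums_summable)
qed

lemma ex1_hermite:
  "\<exists>!H :: nat \<Rightarrow> real poly.
     \<forall>z t. (\<lambda>n. poly (H n) z * (t ^ n / fact n)) sums exp (2 * z * t - t ^ 2)"
proof (rule ex_ex1I)
  define c :: "nat \<Rightarrow> real"
    where "c = (\<lambda>n. if even n then (-1) ^ (n div 2) / fact (n div 2) else 0)"
  define H :: "nat \<Rightarrow> real poly"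
    where "H = (\<lambda>n. smult (fact n) (\<Sum>i\<le>n. monom (2 ^ i / fact i * c (n - i)) i))"
  have "(\<lambda>n. poly (H n) z * (t ^ n / fact n)) sums exp (2 * z * t - t ^ 2)" for z t
  proof -
    let ?a = "\<lambda>n. (2 * z * t) ^ n /\<^sub>R fact n"
    let ?b = "\<lambda>n. c n * t ^ n"
    have b: "?b sums exp (- (t ^ 2))" "summable (\<lambda>n. norm (?b n))"
      using exp_neg_square_sums[of t] by (simp_all only: c_def)
    have "(\<lambda>n. \<Sum>i\<le>n. ?a i * ?b (n - i)) sums ((\<Sum>n. ?a n) * (\<Sum>n. ?b n))"
      by (rule Cauchy_product_sums[OF summable_norm_exp b(2)])
    also have "(\<Sum>n. ?a n) * (\<Sum>n. ?b n) = exp (2 * z * t - t ^ 2)"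
    proof -
      have "(\<Sum>n. ?a n) = exp (2 * z * t)" by (simp only: exp_def)
      moreover have "(\<Sum>n. ?b n) = exp (- (t ^ 2))" using b(1) by (rule sums_unique[symmetric])
      ultimately show ?thesis by (simp flip: exp_add)
    qed
    also have "(\<lambda>n. \<Sum>i\<le>n. ?a i * ?b (n - i)) = (\<lambda>n. poly (H n) z * (t ^ n / fact n))"
    proof
      fix n
      have "?a i * ?b (n - i) = 2 ^ i / fact i * c (n - i) * z ^ i * t ^ n" if "i \<le> n" for i
      proof -
        have "t ^ n = t ^ i * t ^ (n - i)" using that by (simp flip: power_add)
        then show ?thesis by (simp add: power_mult_distrib field_simps)
      qed
      then have "(\<Sum>i\<le>n. ?a i * ?b (n - i))
          = (\<Sum>i\<le>n. 2 ^ i / fact i * c (n - i) * z ^ i * t ^ n)"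
        by (intro sum.cong) auto
      also have "\<dots> = poly (H n) z * (t ^ n / fact n)"
        by (simp add: H_def poly_sum poly_monom sum_distrib_right)
      finally show "(\<Sum>i\<le>n. ?a i * ?b (n - i)) = poly (H n) z * (t ^ n / fact n)" .
    qed
    finally show ?thesis .
  qed
  then show "\<exists>H :: nat \<Rightarrow> real poly.
      \<forall>z t. (\<lambda>n. poly (H n) z * (t ^ n / fact n)) sums exp (2 * z * t - t ^ 2)" by blast
next
  fix G H :: "nat \<Rightarrow> real poly"
  assume G: "\<forall>z t. (\<lambda>n. poly (G n) z * (t ^ n / fact n)) sums exp (2 * z * t - t ^ 2)"
     and H: "\<forall>z t. (\<lambda>n. poly (H n) z * (t ^ n / fact n)) sums exp (2 * z * t - t ^ 2)"
  have "poly (G n) z = poly (H n) z" for n z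
  proof -
    have "(\<lambda>n. (poly (G n) z - poly (H n) z) / fact n * t ^ n) sums 0" for t
      using sums_diff[OF G[rule_format, of z t] H[rule_format, of z t]]
      by (simp add: field_simps)
    then have "(poly (G n) z - poly (H n) z) / fact n = 0"
      by (rule powser_sums_zero_imp_coeff_zero)
    then show ?thesis by simp
  qed
  then show "G = H" by (simp add: fun_eq_iff flip: poly_eq_poly_eq_iff)
qed

(* The generating function identity for real z and t already determines the family,
   see ex1_hermite. *)
definition hermite :: "nat \<Rightarrow> real poly" where
  "hermite = (THE H. \<forall>z t.
     (\<lambda>n. poly (H n) z * (t ^ n / fact n)) sums exp (2 * z * t - t ^ 2))"

lemma hermite_sums:
  "(\<lambda>n. poly (hermite n) z * (t ^ n / fact n)) sums exp (2 * z * t - t ^ 2)"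
  unfolding hermite_def using theI'[OF ex1_hermite] by blast

definition superosc_coeff :: "nat \<Rightarrow> nat \<Rightarrow> real \<Rightarrow> real" where
  "superosc_coeff k w x =
     (if k \<le> w
      then real (w choose k) * ((1 + x) / 2) ^ (w - k) * ((1 - x) / 2) ^ k
      else 0)"

end

theory Submission
  imports Defs
begin

text \<open>
  Multiplying the power series of \<open>exp (- t\<^sup>2)\<close> and \<open>exp (2 * z * t)\<close> and comparing coefficients
  gives the explicit Hermite polynomial
  \<open>H\<^sub>m(z) = m! (\<Sum>j\<le>m/2. (-1)^j (2z)^(m-2j) / (j! (m-2j)!))\<close> (lemma \<open>poly_hermite_explicit\<close>).
  At \<open>z = (1+x)/4\<close> and \<open>m = n-k\<close> the powers of \<open>2z\<close> become \<open>((1+x)/2)^(n-2j-k)\<close>, which together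
  with the prefactor \<open>((1-x)/2)^k\<close> are the powers in the superoscillatory coefficient
  \<open>c\<^sub>k(n-2j,x)\<close>. The factorials then match because \<open>binom(n-2j,k) / (n-2j)! = 1 / (k! (n-2j-k)!)\<close>
  and \<open>n! / binom(n,k) = k! (n-k)!\<close>. The Hermite sum runs over \<open>j \<le> (n-k)/2\<close>, and extending it
  to \<open>j \<le> n/2\<close> adds only terms with \<open>n-2j < k\<close>, whose superoscillatory coefficients are zero.
\<close>

text \<open>
  By uniqueness of power series coefficients, the coefficient of \<open>t^m\<close> in the generating function
  is the Cauchy product of the coefficients of \<open>exp (- t\<^sup>2)\<close>, which live in even degrees \<open>2j\<close> only,
  with those of \<open>exp (2 * z * t)\<close>.
\<close>

lemma poly_hermite_explicit:
  "poly (hermite m) z =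
     fact m * (\<Sum>j = 0..m div 2. (-1) ^ j * (2 * z) ^ (m - 2 * j) / (fact j * fact (m - 2 * j)))"
proof -
  define c :: "nat \<Rightarrow> real"
    where "c = (\<lambda>n. if even n then (-1) ^ (n div 2) / fact (n div 2) else 0)"
  define d where "d = (\<lambda>n. \<Sum>i\<le>n. c i * ((2 * z) ^ (n - i) / fact (n - i)))"
  have d_sums: "(\<lambda>n. d n * t ^ n) sums exp (2 * z * t - t ^ 2)" for t
  proof -
    let ?a = "\<lambda>n. (2 * z * t) ^ n /\<^sub>R fact n"
    let ?b = "\<lambda>n. c n * t ^ n"
    have b: "?b sums exp (- (t ^ 2))" "summable (\<lambda>n. norm (?b n))"
      using exp_neg_square_sums[of t] by (simp_all only: c_def)
    have "(\<lambda>n. \<Sum>i\<le>n. ?b i * ?a (n - i)) sums ((\<Sum>n. ?b n) * (\<Sum>n. ?a n))"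
      by (rule Cauchy_product_sums[OF b(2) summable_norm_exp])
    moreover have "(\<Sum>n. ?b n) * (\<Sum>n. ?a n) = exp (2 * z * t - t ^ 2)"
    proof -
      have "(\<Sum>n. ?a n) = exp (2 * z * t)" by (simp only: exp_def)
      with sums_unique[OF b(1), symmetric] show ?thesis by (simp only: flip: exp_add) simp
    qed
    moreover have "(\<Sum>i\<le>n. ?b i * ?a (n - i)) = d n * t ^ n" for n
    proof -
      have "?b i * ?a (n - i) = c i * ((2 * z) ^ (n - i) / fact (n - i)) * t ^ n" if "i \<le> n" for i
      proof -
        have "t ^ n = t ^ i * t ^ (n - i)" using that by (simp flip: power_add)
        then show ?thesis by (simp add: power_mult_distrib field_simps)
      qed
      then show ?thesis by (simp add: d_def sum_distrib_right)
    qed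
    ultimately show ?thesis by simp
  qed
  have "(\<lambda>n. (poly (hermite n) z / fact n - d n) * t ^ n) sums 0" for t
    using sums_diff[OF hermite_sums[of z t] d_sums[of t]] by (simp add: algebra_simps)
  then have "poly (hermite m) z / fact m - d m = 0"
    by (rule powser_sums_zero_imp_coeff_zero)
  then have "poly (hermite m) z = fact m * d m" by (simp add: field_simps)
  also have "d m = (\<Sum>i\<in>(*) 2 ` {0..m div 2}. c i * ((2 * z) ^ (m - i) / fact (m - i)))"
    unfolding d_def by (rule sum.mono_neutral_right) (auto simp: c_def elim!: evenE)
  also have "\<dots> = (\<Sum>j = 0..m div 2. (-1) ^ j * (2 * z) ^ (m - 2 * j) / (fact j * fact (m - 2 * j)))"
    by (subst sum.reindex) (auto simp: inj_on_def c_def)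
  finally show ?thesis .
qed

theorem theorem3p5:
  fixes x :: real and n k :: nat
  assumes "x > 1" and "k \<le> n"
  shows "((1 - x) / 2) ^ k * poly (hermite (n - k)) ((1 + x) / 4) =
    fact n / real (n choose k) *
      (\<Sum>j = 0..n div 2.
        (-1) ^ j * superosc_coeff k (n - 2 * j) x / (fact j * fact (n - 2 * j)))"
proof -
  define p q where "p = (1 + x) / 2" and "q = (1 - x) / 2"
  let ?s = "\<lambda>j. (-1) ^ j * superosc_coeff k (n - 2 * j) x / (fact j * fact (n - 2 * j))"
  let ?h = "\<lambda>j. (-1) ^ j * p ^ (n - k - 2 * j) / (fact j * fact (n - k - 2 * j))"
  have term_eq: "fact k * ?s j = q ^ k * ?h j" if "j \<le> (n - k) div 2" for j
  proof -
    have le: "k \<le> n - 2 * j" using that assms(2) by linarith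
    have "real (n - 2 * j choose k) = fact (n - 2 * j) / (fact k * fact (n - k - 2 * j))"
      using binomial_fact[OF le, where 'a = real] by (simp add: add.commute)
    then show ?thesis
      using le by (simp add: superosc_coeff_def p_def q_def add.commute mult_ac)
  qed
  have "2 * ((1 + x) / 4) = p" by (simp add: p_def)
  then have "q ^ k * poly (hermite (n - k)) ((1 + x) / 4)
      = fact (n - k) * (\<Sum>j = 0..(n - k) div 2. q ^ k * ?h j)"
    by (simp only: poly_hermite_explicit) (simp add: sum_distrib_left mult_ac)
  also have "\<dots> = fact (n - k) * (\<Sum>j = 0..(n - k) div 2. fact k * ?s j)"
    using term_eq by simp
  also have "\<dots> = fact k * fact (n - k) * (\<Sum>j = 0..(n - k) div 2. ?s j)"
    by (simp add: sum_distrib_left mult_ac)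
  also have "(\<Sum>j = 0..(n - k) div 2. ?s j) = (\<Sum>j = 0..n div 2. ?s j)"
    using assms(2) by (intro sum.mono_neutral_left) (auto simp: superosc_coeff_def div_le_mono)
  also have "fact k * fact (n - k) = fact n / real (n choose k)"
    using binomial_fact[OF assms(2), where 'a = real] by simp
  finally show ?thesis by (simp add: q_def)
qed

end
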